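(* For every constant $a>0$, the Riemannian submersion $$\pi^a:H^2\big(-\tfrac{1}{a^2}\big)\times\mathbb{R}=\Big(\mathbb{R}^3_+,\ \frac{a^2(dx^2+dy^2)}{y^2}+dz^2\Big)\to\Big(\{(y,z)\in\mathbb{R}^2:y>0\},\ \frac{a^2dy^2}{y^2}+dz^2\Big),\qquad \pi^a(x,y,z)=(y,z),$$ is a proper biharmonic map from $H^2(-\frac1{a^2})\times\mathbb{R}$ to the Euclidean plane $\mathbb{R}^2$. In particular, for $a=1$, the Riemannian submersion $$\pi^1:H^2(-1)\times\mathbb{R}=\Big(\mathbb{R}^3_+,\ \frac{dx^2+dy^2}{y^2}+dz^2\Big)\to\Big(\{(y,z)\in\mathbb{R}^2:y>0\},\ \frac{dy^2}{y^2}+dz^2\Big),\qquad \pi^1(x,y,z)=(y,z),$$ is a proper biharmonic map.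
   Context: $\mathbb{R}^3_+=\{(x,y,z)\in\mathbb{R}^3: y>0\}$, and $H^2(c)$ denotes the hyperbolic plane of constant curvature $c<0$ (upper half-plane model). The target metric is flat and the target is isometric to the Euclidean plane via $(y,z)\mapsto(a\ln y,z)$. For a smooth map $\varphi:(M,g)\to(N,h)$ between Riemannian manifolds, the tension field is $\tau(\varphi)=\mathrm{Trace}_g\nabla d\varphi$; $\varphi$ is harmonic if $\tau(\varphi)=0$. The map $\varphi$ is biharmonic if its bitension field vanishes: $$\tau^2(\varphi)=\mathrm{Trace}_g\big(\nabla^{\varphi}\nabla^{\varphi}-\nabla^{\varphi}_{\nabla^{M}}\big)\tau(\varphi)-\mathrm{Trace}_g R^N(d\varphi,\tau(\varphi))d\varphi=0,$$ where $R^N(X,Y)Z=[\nabla^N_X,\nabla^N_Y]Z-\nabla^N_{[X,Y]}Z$. A proper biharmonic map is a biharmonic map that is not harmonic. *)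

theory Defs
  imports "HOL-Analysis.Analysis"
begin

text \<open>
  All manifolds are open subsets U of a Euclidean space 'a, described by one global chart.
  Tangent vectors at a point of U are elements of 'a, vector fields are functions from 'a
  to 'a, and a metric assigns to every point a bilinear form on 'a. Only the values on U matter.
\<close>

type_synonym 'a metric_tensor = "'a \<Rightarrow> 'a \<Rightarrow> 'a \<Rightarrow> real"

abbreviation D :: "('a::real_normed_vector \<Rightarrow> 'b::real_normed_vector) \<Rightarrow> 'a \<Rightarrow> 'a \<Rightarrow> 'b" where
  "D f p \<equiv> frechet_derivative f (at p)"

fun Ck_on :: "nat \<Rightarrow> 'a::euclidean_space set \<Rightarrow> ('a \<Rightarrow> 'b::euclidean_space) \<Rightarrow> bool" where
  "Ck_on 0 U f \<longleftrightarrow> continuous_on U f"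
| "Ck_on (Suc k) U f \<longleftrightarrow> (\<forall>p\<in>U. f differentiable (at p)) \<and> (\<forall>v. Ck_on k U (\<lambda>p. D f p v))"

definition smooth_map_on :: "'a::euclidean_space set \<Rightarrow> ('a \<Rightarrow> 'b::euclidean_space) \<Rightarrow> bool" where
  "smooth_map_on U f \<longleftrightarrow> (\<forall>k. Ck_on k U f)"

definition riemannian_manifold :: "'a::euclidean_space set \<Rightarrow> 'a metric_tensor \<Rightarrow> bool" where
  "riemannian_manifold U g \<longleftrightarrow> open U
     \<and> (\<forall>p\<in>U. bilinear (g p)
          \<and> (\<forall>u v. g p u v = g p v u)
          \<and> (\<forall>u. u \<noteq> 0 \<longrightarrow> g p u u > 0))
     \<and> (\<forall>u v. smooth_map_on U (\<lambda>p. g p u v))"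

text \<open>The index-raising isomorphism: the vector that represents a covector through the metric.\<close>

definition sharp :: "'a::euclidean_space metric_tensor \<Rightarrow> 'a \<Rightarrow> ('a \<Rightarrow> real) \<Rightarrow> 'a" where
  "sharp g p \<alpha> = (THE w. \<forall>v. g p w v = \<alpha> v)"

text \<open>
  The trace of a vector-valued bilinear form B, i.e. the sum of $g^{ij} B(e_i, e_j)$ over the
  coordinate frame: the vector $g^{ij} e_j$ is obtained by raising the index of the
  coordinate covector $dx^i$.
\<close>

definition metric_trace ::
  "'a::euclidean_space metric_tensor \<Rightarrow> 'a \<Rightarrow> ('a \<Rightarrow> 'a \<Rightarrow> 'b::real_vector) \<Rightarrow> 'b" where
  "metric_trace g p B = (\<Sum>b\<in>Basis. B b (sharp g p (\<lambda>v. b \<bullet> v)))"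

text \<open>
  The Christoffel symbols $\Gamma^k_{ij} u^i v^j e_k$ of the Levi-Civita connection, with
  $\Gamma_{ijl} = (\partial_i g_{jl} + \partial_j g_{il} - \partial_l g_{ij}) / 2$.
\<close>

definition christoffel :: "'a::euclidean_space metric_tensor \<Rightarrow> 'a \<Rightarrow> 'a \<Rightarrow> 'a \<Rightarrow> 'a" where
  "christoffel g p u v = sharp g p (\<lambda>w.
     (D (\<lambda>q. g q v w) p u + D (\<lambda>q. g q u w) p v - D (\<lambda>q. g q u v) p w) / 2)"

definition levi_civita ::
  "'a::euclidean_space metric_tensor \<Rightarrow> ('a \<Rightarrow> 'a) \<Rightarrow> ('a \<Rightarrow> 'a) \<Rightarrow> 'a \<Rightarrow> 'a" where
  "levi_civita g X Y = (\<lambda>p. D Y p (X p) + christoffel g p (X p) (Y p))"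

definition lie_bracket ::
  "('a::euclidean_space \<Rightarrow> 'a) \<Rightarrow> ('a \<Rightarrow> 'a) \<Rightarrow> 'a \<Rightarrow> 'a" where
  "lie_bracket X Y = (\<lambda>p. D Y p (X p) - D X p (Y p))"

definition curvature ::
  "'a::euclidean_space metric_tensor \<Rightarrow> ('a \<Rightarrow> 'a) \<Rightarrow> ('a \<Rightarrow> 'a) \<Rightarrow> ('a \<Rightarrow> 'a) \<Rightarrow> 'a \<Rightarrow> 'a" where
  "curvature g X Y Z = (\<lambda>p.
     levi_civita g X (levi_civita g Y Z) p - levi_civita g Y (levi_civita g X Z) p
     - levi_civita g (lie_bracket X Y) Z p)"

text \<open>
  Tensors are evaluated on tangent vectors at a point by extending these to vector fields
  that are constant in the chart; by tensoriality the choice of extension is irrelevant.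
\<close>

definition curvature_at :: "'a::euclidean_space metric_tensor \<Rightarrow> 'a \<Rightarrow> 'a \<Rightarrow> 'a \<Rightarrow> 'a \<Rightarrow> 'a" where
  "curvature_at g p u v w = curvature g (\<lambda>_. u) (\<lambda>_. v) (\<lambda>_. w) p"

text \<open>Constant sectional curvature c; linearly dependent u, v satisfy the equation trivially.\<close>

definition constant_curvature ::
  "'a::euclidean_space set \<Rightarrow> 'a metric_tensor \<Rightarrow> real \<Rightarrow> bool" where
  "constant_curvature U g c \<longleftrightarrow> riemannian_manifold U g \<and>
     (\<forall>p\<in>U. \<forall>u v. g p (curvature_at g p u v v) u = c * (g p u u * g p v v - (g p u v)\<^sup>2))"

definition smooth_manifold_map ::
  "'a::euclidean_space set \<Rightarrow> 'a metric_tensor \<Rightarrow> 'b::euclidean_space set \<Rightarrow> 'b metric_tensor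
     \<Rightarrow> ('a \<Rightarrow> 'b) \<Rightarrow> bool" where
  "smooth_manifold_map U g V h \<phi> \<longleftrightarrow> riemannian_manifold U g \<and> riemannian_manifold V h
     \<and> \<phi> ` U \<subseteq> V \<and> smooth_map_on U \<phi>"

definition isometry_between ::
  "'a::euclidean_space set \<Rightarrow> 'a metric_tensor \<Rightarrow> 'b::euclidean_space set \<Rightarrow> 'b metric_tensor
     \<Rightarrow> ('a \<Rightarrow> 'b) \<Rightarrow> bool" where
  "isometry_between U g V h \<phi> \<longleftrightarrow> smooth_manifold_map U g V h \<phi>
     \<and> bij_betw \<phi> U V \<and> smooth_map_on V (inv_into U \<phi>)
     \<and> (\<forall>p\<in>U. \<forall>u v. h (\<phi> p) (D \<phi> p u) (D \<phi> p v) = g p u v)"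

definition riemannian_submersion ::
  "'a::euclidean_space set \<Rightarrow> 'a metric_tensor \<Rightarrow> 'b::euclidean_space set \<Rightarrow> 'b metric_tensor
     \<Rightarrow> ('a \<Rightarrow> 'b) \<Rightarrow> bool" where
  "riemannian_submersion U g V h \<phi> \<longleftrightarrow> smooth_manifold_map U g V h \<phi> \<and> \<phi> ` U = V
     \<and> (\<forall>p\<in>U. surj (D \<phi> p)
          \<and> (let horizontal = {u. \<forall>k. D \<phi> p k = 0 \<longrightarrow> g p u k = 0}
             in \<forall>u\<in>horizontal. \<forall>v\<in>horizontal. h (\<phi> p) (D \<phi> p u) (D \<phi> p v) = g p u v))"

text \<open>
  The connection that the Levi-Civita connection of h induces on the pull-back of the tangent
  bundle along the map; sections of that bundle are functions from 'a to 'b.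
\<close>

definition pullback_connection ::
  "'b::euclidean_space metric_tensor \<Rightarrow> ('a::euclidean_space \<Rightarrow> 'b) \<Rightarrow> ('a \<Rightarrow> 'a) \<Rightarrow> ('a \<Rightarrow> 'b)
     \<Rightarrow> 'a \<Rightarrow> 'b" where
  "pullback_connection h \<phi> X V =
     (\<lambda>p. D V p (X p) + christoffel h (\<phi> p) (D \<phi> p (X p)) (V p))"

text \<open>$\nabla d\varphi(X, Y) = \nabla^\varphi_X (d\varphi\,Y) - d\varphi(\nabla_X Y)$.\<close>

definition second_fundamental_form ::
  "'a::euclidean_space metric_tensor \<Rightarrow> 'b::euclidean_space metric_tensor \<Rightarrow> ('a \<Rightarrow> 'b)
     \<Rightarrow> 'a \<Rightarrow> 'a \<Rightarrow> 'a \<Rightarrow> 'b" where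
  "second_fundamental_form g h \<phi> p u v =
     pullback_connection h \<phi> (\<lambda>_. u) (\<lambda>q. D \<phi> q v) p
     - D \<phi> p (levi_civita g (\<lambda>_. u) (\<lambda>_. v) p)"

definition tension_field ::
  "'a::euclidean_space metric_tensor \<Rightarrow> 'b::euclidean_space metric_tensor \<Rightarrow> ('a \<Rightarrow> 'b)
     \<Rightarrow> 'a \<Rightarrow> 'b" where
  "tension_field g h \<phi> p = metric_trace g p (second_fundamental_form g h \<phi> p)"

definition second_covariant_derivative ::
  "'a::euclidean_space metric_tensor \<Rightarrow> 'b::euclidean_space metric_tensor \<Rightarrow> ('a \<Rightarrow> 'b)
     \<Rightarrow> ('a \<Rightarrow> 'b) \<Rightarrow> 'a \<Rightarrow> 'a \<Rightarrow> 'a \<Rightarrow> 'b" where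
  "second_covariant_derivative g h \<phi> V p u v =
     pullback_connection h \<phi> (\<lambda>_. u) (pullback_connection h \<phi> (\<lambda>_. v) V) p
     - pullback_connection h \<phi> (levi_civita g (\<lambda>_. u) (\<lambda>_. v)) V p"

definition bitension_field ::
  "'a::euclidean_space metric_tensor \<Rightarrow> 'b::euclidean_space metric_tensor \<Rightarrow> ('a \<Rightarrow> 'b)
     \<Rightarrow> 'a \<Rightarrow> 'b" where
  "bitension_field g h \<phi> p =
     metric_trace g p (second_covariant_derivative g h \<phi> (tension_field g h \<phi>) p)
     - metric_trace g p (\<lambda>u v.
         curvature_at h (\<phi> p) (D \<phi> p u) (tension_field g h \<phi> p) (D \<phi> p v))"

definition harmonic_map ::
  "'a::euclidean_space set \<Rightarrow> 'a metric_tensor \<Rightarrow> 'b::euclidean_space set \<Rightarrow> 'b metric_tensor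
     \<Rightarrow> ('a \<Rightarrow> 'b) \<Rightarrow> bool" where
  "harmonic_map U g V h \<phi> \<longleftrightarrow>
     smooth_manifold_map U g V h \<phi> \<and> (\<forall>p\<in>U. tension_field g h \<phi> p = 0)"

definition biharmonic_map ::
  "'a::euclidean_space set \<Rightarrow> 'a metric_tensor \<Rightarrow> 'b::euclidean_space set \<Rightarrow> 'b metric_tensor
     \<Rightarrow> ('a \<Rightarrow> 'b) \<Rightarrow> bool" where
  "biharmonic_map U g V h \<phi> \<longleftrightarrow>
     smooth_manifold_map U g V h \<phi> \<and> (\<forall>p\<in>U. bitension_field g h \<phi> p = 0)"

definition proper_biharmonic_map ::
  "'a::euclidean_space set \<Rightarrow> 'a metric_tensor \<Rightarrow> 'b::euclidean_space set \<Rightarrow> 'b metric_tensor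
     \<Rightarrow> ('a \<Rightarrow> 'b) \<Rightarrow> bool" where
  "proper_biharmonic_map U g V h \<phi> \<longleftrightarrow>
     biharmonic_map U g V h \<phi> \<and> \<not> harmonic_map U g V h \<phi>"

definition flat_metric :: "'a::euclidean_space metric_tensor" where
  "flat_metric p u v = u \<bullet> v"

definition product_metric ::
  "'a::euclidean_space metric_tensor \<Rightarrow> 'b::euclidean_space metric_tensor
     \<Rightarrow> ('a \<times> 'b) metric_tensor" where
  "product_metric g h = (\<lambda>(p, q) (u, u') (v, v'). g p u v + h q u' v')"

text \<open>The upper half-plane model of the hyperbolic plane of curvature c < 0.\<close>

definition half_plane :: "(real \<times> real) set" where
  "half_plane = {(x, y). y > 0}"

definition hyperbolic_metric :: "real \<Rightarrow> (real \<times> real) metric_tensor" where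
  "hyperbolic_metric c = (\<lambda>(x, y) (u1, u2) (v1, v2). (u1 * v1 + u2 * v2) / (- c * y\<^sup>2))"

definition upper_half_space :: "(real \<times> real \<times> real) set" where
  "upper_half_space = {(x, y, z). y > 0}"

text \<open>The metric $a^2 (dx^2 + dy^2) / y^2 + dz^2$ on the upper half-space.\<close>

definition source_metric :: "real \<Rightarrow> (real \<times> real \<times> real) metric_tensor" where
  "source_metric a = (\<lambda>(x, y, z) (u1, u2, u3) (v1, v2, v3).
     a\<^sup>2 * (u1 * v1 + u2 * v2) / y\<^sup>2 + u3 * v3)"

text \<open>
  The target is also a half-plane, but here the positive coordinate y is the first one.
  Its metric is $a^2 dy^2 / y^2 + dz^2$.
\<close>

definition target_half_plane :: "(real \<times> real) set" where
  "target_half_plane = {(y, z). y > 0}"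

definition target_metric :: "real \<Rightarrow> (real \<times> real) metric_tensor" where
  "target_metric a = (\<lambda>(y, z) (u1, u2) (v1, v2). a\<^sup>2 * (u1 * v1) / y\<^sup>2 + u2 * v2)"

definition proj :: "real \<times> real \<times> real \<Rightarrow> real \<times> real" where
  "proj = (\<lambda>(x, y, z). (y, z))"

end

theory Submission
  imports Defs
begin

text \<open>
  Write $h$ for the target metric. The projection kills the direction $\partial_x$ of the fibres
  and is an isometry on its orthogonal complement, spanned by $\partial_y$ and $\partial_z$. The
  fibres are horocycles of the hyperbolic factor, whose geodesic curvature is a nonzero constant.
  Hence only the term $-d\pi(\nabla_{\partial_x}\partial_x)$ contributes to the trace of the second
  fundamental form, and the tension field is $-(y/a^2)\,\partial_y$; it vanishes nowhere, so $\pi$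
  is not harmonic (lemma \<open>tension_field_proj\<close>).

  In the flat coordinate $s = a \ln y$ of the target this field is $-(1/a)\,\partial_s$, a
  constant field on the Euclidean plane. It is therefore parallel along $\pi$ (lemma
  \<open>tension_field_proj_parallel\<close>). Both parts of the bitension field then vanish: the
  first because it consists of covariant derivatives of the tension field, the second because $h$ has no
  curvature (lemmas \<open>bitension_field_zero_if_parallel\<close> and
  \<open>curvature_target_zero\<close>).

  The remaining claims are verified in the given charts. In all three metrics the Christoffel
  symbols are $y^{-1}$ times a constant bilinear map, so that one derivative formula, lemma
  \<open>D_inverse_coordinate\<close>, yields the curvature of both half-planes.
\<close>

section \<open>Smooth maps\<close>

lemma has_derivative_D: "(f has_derivative f') (at p) \<Longrightarrow> D f p = f'"
  by (rule frechet_derivative_at[symmetric])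

text \<open>
  Geometric data are known on an open set $U$ only, while \<open>D\<close> sees the whole space. This
  lemma allows an object to be replaced by its formula on $U$ under \<open>D\<close>: functions that agree
  near a point have the same set of derivatives there, from which \<open>D\<close> chooses.
\<close>

lemma differentiable_cong_open:
  assumes "open U" "p \<in> U" "\<And>q. q \<in> U \<Longrightarrow> f q = g q"
  shows "f differentiable (at p) \<longleftrightarrow> g differentiable (at p)"
    and "D f p = D g p"
proof -
  have "(f has_derivative f') (at p) \<longleftrightarrow> (g has_derivative f') (at p)" for f'
    using assms by (metis has_derivative_transform_within_open)
  then show "f differentiable (at p) \<longleftrightarrow> g differentiable (at p)" "D f p = D g p"
    by (simp_all add: differentiable_def frechet_derivative_def)
qed

lemma Ck_on_cong:
  assumes "open U"
  shows "(\<And>p. p \<in> U \<Longrightarrow> f p = g p) \<Longrightarrow> Ck_on k U f \<longleftrightarrow> Ck_on k U g"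
proof (induction k arbitrary: f g)
  case 0
  then show ?case by (simp cong: continuous_on_cong)
next
  case (Suc k)
  have "Ck_on k U (\<lambda>p. D f p v) \<longleftrightarrow> Ck_on k U (\<lambda>p. D g p v)" for v
  proof (rule Suc.IH)
    show "D f p v = D g p v" if "p \<in> U" for p
      using differentiable_cong_open(2)[OF assms that Suc.prems] by simp
  qed
  moreover have "f differentiable (at p) \<longleftrightarrow> g differentiable (at p)" if "p \<in> U" for p
    using differentiable_cong_open(1)[OF assms that Suc.prems] .
  ultimately show ?case by simp
qed

text \<open>
  The class $C^{k+1}$ is defined through the chosen derivative \<open>D\<close>; with this rule any
  pointwise formula for the derivative can take its place.
\<close>

lemma Ck_on_SucI:
  assumes "open U" "\<And>p. p \<in> U \<Longrightarrow> (f has_derivative f' p) (at p)"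
    "\<And>v. Ck_on k U (\<lambda>p. f' p v)"
  shows "Ck_on (Suc k) U f"
proof -
  have "D f p = f' p" if "p \<in> U" for p
    by (rule has_derivative_D[OF assms(2)[OF that]])
  then have "Ck_on k U (\<lambda>p. D f p v) \<longleftrightarrow> Ck_on k U (\<lambda>p. f' p v)" for v
    by (intro Ck_on_cong[OF assms(1)]) (rule fun_cong)
  moreover have "f differentiable (at p)" if "p \<in> U" for p
    using assms(2)[OF that] by (rule differentiableI)
  ultimately show ?thesis using assms(3) by simp
qed

lemma Ck_on_SucD:
  assumes "Ck_on (Suc k) U f"
  shows "p \<in> U \<Longrightarrow> (f has_derivative D f p) (at p)" "Ck_on k U (\<lambda>p. D f p v)"
  using assms by (auto simp: frechet_derivative_works)

lemma Ck_on_lower: "Ck_on (Suc k) U f \<Longrightarrow> Ck_on k U f"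
proof (induction k arbitrary: f)
  case 0
  then show ?case
    by (auto simp: intro!: continuous_at_imp_continuous_on differentiable_imp_continuous_within)
qed auto

lemma Ck_on_const: "Ck_on k U (\<lambda>_. c)"
  by (induction k arbitrary: c) auto

lemma Ck_on_bounded_linear_compose:
  assumes "open U" "bounded_linear L"
  shows "Ck_on k U f \<Longrightarrow> Ck_on k U (\<lambda>p. L (f p))"
proof (induction k arbitrary: f)
  case 0
  then show ?case
    using assms by (auto intro: bounded_linear.continuous_on)
next
  case (Suc k)
  show ?case
    by (rule Ck_on_SucI[OF assms(1)])
       (use Suc assms Ck_on_SucD[OF Suc.prems] in
         \<open>auto intro: bounded_linear.has_derivative simp del: Ck_on.simps\<close>)
qed

lemma Ck_on_bounded_linear:
  assumes "open U" "bounded_linear L"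
  shows "Ck_on k U L"
proof (cases k)
  case 0
  then show ?thesis using assms by (auto intro: linear_continuous_on)
next
  case (Suc m)
  then show ?thesis
    using assms
    by (auto simp del: Ck_on.simps intro!: Ck_on_SucI Ck_on_const bounded_linear_imp_has_derivative)
qed

lemma Ck_on_add:
  assumes "open U"
  shows "Ck_on k U f \<Longrightarrow> Ck_on k U g \<Longrightarrow> Ck_on k U (\<lambda>p. f p + g p)"
proof (induction k arbitrary: f g)
  case 0
  then show ?case by (auto intro: continuous_on_add)
next
  case (Suc k)
  show ?case
    by (rule Ck_on_SucI[OF assms, where f' = "\<lambda>p v. D f p v + D g p v"])
       (use Suc.IH Ck_on_SucD[OF Suc.prems(1)] Ck_on_SucD[OF Suc.prems(2)] in
         \<open>auto intro!: has_derivative_add simp del: Ck_on.simps\<close>)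
qed

lemma Ck_on_mult:
  fixes f g :: "'a::euclidean_space \<Rightarrow> real"
  assumes "open U"
  shows "Ck_on k U f \<Longrightarrow> Ck_on k U g \<Longrightarrow> Ck_on k U (\<lambda>p. f p * g p)"
proof (induction k arbitrary: f g)
  case 0
  then show ?case by (auto intro: continuous_on_mult)
next
  case (Suc k)
  show ?case
    by (rule Ck_on_SucI[OF assms, where f' = "\<lambda>p v. f p * D g p v + D f p v * g p"])
       (use Suc.IH Ck_on_SucD[OF Suc.prems(1)] Ck_on_SucD[OF Suc.prems(2)]
         Ck_on_lower[OF Suc.prems(1)] Ck_on_lower[OF Suc.prems(2)] assms in
         \<open>auto intro!: has_derivative_mult Ck_on_add simp del: Ck_on.simps\<close>)
qed

text \<open>
  For $\exp$, inversion and $\ln$ the derivative \<open>F'\<close> is a product of functions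
  known to be $C^k$ after composition with \<open>f\<close>, either by induction on $k$ or by an earlier
  lemma. So this step replaces the chain rule of arbitrary order.
\<close>

lemma Ck_on_compose_Suc:
  fixes f :: "'a::euclidean_space \<Rightarrow> real" and F :: "real \<Rightarrow> real"
  assumes "open U" "Ck_on (Suc k) U f"
    and F: "\<And>p. p \<in> U \<Longrightarrow> (F has_real_derivative F' (f p)) (at (f p))"
    and F': "Ck_on k U (\<lambda>p. F' (f p))"
  shows "Ck_on (Suc k) U (\<lambda>p. F (f p))"
proof (rule Ck_on_SucI[OF assms(1)])
  show "((\<lambda>p. F (f p)) has_derivative (\<lambda>v. F' (f p) * D f p v)) (at p)" if "p \<in> U" for p
    using has_derivative_compose[OF Ck_on_SucD(1)[OF assms(2) that]
        F[OF that, unfolded has_field_derivative_def]] .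
  show "Ck_on k U (\<lambda>p. F' (f p) * D f p v)" for v
    by (rule Ck_on_mult[OF assms(1) F' Ck_on_SucD(2)[OF assms(2)]])
qed

lemma Ck_on_exp:
  fixes f :: "'a::euclidean_space \<Rightarrow> real"
  assumes "open U"
  shows "Ck_on k U f \<Longrightarrow> Ck_on k U (\<lambda>p. exp (f p))"
proof (induction k)
  case 0
  then show ?case by (auto intro: continuous_on_exp)
next
  case (Suc k)
  show ?case
    by (rule Ck_on_compose_Suc[OF assms Suc.prems])
       (use Suc.IH Ck_on_lower[OF Suc.prems] in \<open>auto intro!: derivative_eq_intros\<close>)
qed

lemma Ck_on_inverse:
  fixes f :: "'a::euclidean_space \<Rightarrow> real"
  assumes "open U" "\<And>p. p \<in> U \<Longrightarrow> f p \<noteq> 0"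
  shows "Ck_on k U f \<Longrightarrow> Ck_on k U (\<lambda>p. inverse (f p))"
proof (induction k)
  case 0
  then show ?case using assms by (auto intro: continuous_on_inverse)
next
  case (Suc k)
  have "Ck_on k U (\<lambda>p. inverse (f p))"
    using Suc.IH Ck_on_lower[OF Suc.prems] by blast
  then have "Ck_on k U (\<lambda>p. - 1 * (inverse (f p) * inverse (f p)))"
    using assms by (intro Ck_on_mult Ck_on_const)
  then show ?case
    by (intro Ck_on_compose_Suc[OF assms(1) Suc.prems, of inverse "\<lambda>t. - 1 * (inverse t * inverse t)"])
       (use assms in \<open>auto intro!: derivative_eq_intros\<close>)
qed

lemma Ck_on_ln:
  fixes f :: "'a::euclidean_space \<Rightarrow> real"
  assumes "open U" "\<And>p. p \<in> U \<Longrightarrow> f p > 0" "Ck_on k U f"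
  shows "Ck_on k U (\<lambda>p. ln (f p))"
proof (cases k)
  case 0
  with assms show ?thesis by (fastforce intro: continuous_on_ln)
next
  case (Suc m)
  have "Ck_on m U (\<lambda>p. inverse (f p))"
    using assms Ck_on_lower[of m U f] Suc by (fastforce intro: Ck_on_inverse)
  then show ?thesis
    using assms unfolding Suc by (auto intro: Ck_on_compose_Suc[where F' = inverse] DERIV_ln
      simp del: Ck_on.simps)
qed

lemma Ck_on_Pair:
  fixes f :: "'a::euclidean_space \<Rightarrow> 'b::euclidean_space" and g :: "'a \<Rightarrow> 'c::euclidean_space"
  assumes "open U" "Ck_on k U f" "Ck_on k U g"
  shows "Ck_on k U (\<lambda>p. (f p, g p))"
proof -
  have L: "bounded_linear (\<lambda>x. (x, 0 :: 'c))" "bounded_linear (\<lambda>y. (0 :: 'b, y))"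
    by (auto intro!: bounded_linear_Pair bounded_linear_ident bounded_linear_zero)
  have "Ck_on k U (\<lambda>p. (f p, 0) + (0, g p))"
    using assms by (intro Ck_on_add Ck_on_bounded_linear_compose[OF _ L(1)]
      Ck_on_bounded_linear_compose[OF _ L(2)])
  then show ?thesis by simp
qed

lemma smooth_const: "smooth_map_on U (\<lambda>_. c)"
  by (simp add: smooth_map_on_def Ck_on_const)

lemma smooth_bounded_linear: "open U \<Longrightarrow> bounded_linear L \<Longrightarrow> smooth_map_on U L"
  by (simp add: smooth_map_on_def Ck_on_bounded_linear)

lemma smooth_add: "open U \<Longrightarrow> smooth_map_on U f \<Longrightarrow> smooth_map_on U g \<Longrightarrow>
    smooth_map_on U (\<lambda>p. f p + g p)"
  by (simp add: smooth_map_on_def Ck_on_add)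

lemma smooth_Pair: "open U \<Longrightarrow> smooth_map_on U f \<Longrightarrow> smooth_map_on U g \<Longrightarrow>
    smooth_map_on U (\<lambda>p. (f p, g p))"
  by (simp add: smooth_map_on_def Ck_on_Pair)

lemma smooth_cong:
  "open U \<Longrightarrow> (\<And>p. p \<in> U \<Longrightarrow> f p = g p) \<Longrightarrow> smooth_map_on U f \<longleftrightarrow> smooth_map_on U g"
  unfolding smooth_map_on_def using Ck_on_cong[of U f g] by simp

lemma smooth_mult: "open U \<Longrightarrow> smooth_map_on U f \<Longrightarrow> smooth_map_on U g \<Longrightarrow>
    smooth_map_on U (\<lambda>p. f p * g p)" for f g :: "'a::euclidean_space \<Rightarrow> real"
  by (simp add: smooth_map_on_def Ck_on_mult)

lemma smooth_exp: "open U \<Longrightarrow> smooth_map_on U f \<Longrightarrow> smooth_map_on U (\<lambda>p. exp (f p))"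
  for f :: "'a::euclidean_space \<Rightarrow> real"
  by (simp add: smooth_map_on_def Ck_on_exp)

lemma smooth_ln: "open U \<Longrightarrow> (\<And>p. p \<in> U \<Longrightarrow> f p > 0) \<Longrightarrow> smooth_map_on U f \<Longrightarrow>
    smooth_map_on U (\<lambda>p. ln (f p))" for f :: "'a::euclidean_space \<Rightarrow> real"
  by (simp add: smooth_map_on_def Ck_on_ln)

lemma smooth_divide: "open U \<Longrightarrow> (\<And>p. p \<in> U \<Longrightarrow> g p \<noteq> 0) \<Longrightarrow>
    smooth_map_on U f \<Longrightarrow> smooth_map_on U g \<Longrightarrow> smooth_map_on U (\<lambda>p. f p / g p)"
  for f g :: "'a::euclidean_space \<Rightarrow> real"
  by (simp add: smooth_map_on_def divide_inverse Ck_on_mult Ck_on_inverse)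

lemma smooth_power2: "open U \<Longrightarrow> smooth_map_on U f \<Longrightarrow> smooth_map_on U (\<lambda>p. (f p)\<^sup>2)"
  for f :: "'a::euclidean_space \<Rightarrow> real"
  by (simp add: power2_eq_square smooth_mult)

lemma smooth_fst: "open U \<Longrightarrow> smooth_map_on U fst"
  by (rule smooth_bounded_linear[OF _ bounded_linear_fst])

lemma smooth_snd: "open U \<Longrightarrow> smooth_map_on U snd"
  by (rule smooth_bounded_linear[OF _ bounded_linear_snd])

lemma smooth_fst_fst: "open U \<Longrightarrow> smooth_map_on U (\<lambda>p. fst (fst p))"
  by (rule smooth_bounded_linear[OF _ bounded_linear_compose[OF bounded_linear_fst bounded_linear_fst]])

lemma smooth_snd_fst: "open U \<Longrightarrow> smooth_map_on U (\<lambda>p. snd (fst p))"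
  by (rule smooth_bounded_linear[OF _ bounded_linear_compose[OF bounded_linear_snd bounded_linear_fst]])

lemma smooth_fst_snd: "open U \<Longrightarrow> smooth_map_on U (\<lambda>p. fst (snd p))"
  by (rule smooth_bounded_linear[OF _ bounded_linear_compose[OF bounded_linear_fst bounded_linear_snd]])

lemma smooth_snd_snd: "open U \<Longrightarrow> smooth_map_on U (\<lambda>p. snd (snd p))"
  by (rule smooth_bounded_linear[OF _ bounded_linear_compose[OF bounded_linear_snd bounded_linear_snd]])

lemmas smooth_intros = smooth_const smooth_add smooth_mult smooth_exp smooth_ln smooth_divide
  smooth_power2 smooth_Pair smooth_fst smooth_snd smooth_fst_fst smooth_snd_fst
  smooth_fst_snd smooth_snd_snd

section \<open>Raising indices and Christoffel symbols\<close>

text \<open>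
  A definite form is nondegenerate, so a vector is determined by the covector that it represents.
\<close>

lemma sharp_eqI:
  assumes g: "riemannian_manifold U g" and "p \<in> U" and w: "\<And>v. g p w v = \<alpha> v"
  shows "sharp g p \<alpha> = w"
  unfolding sharp_def
proof (rule the_equality)
  show "\<forall>v. g p w v = \<alpha> v" using w by simp
next
  fix w' assume w': "\<forall>v. g p w' v = \<alpha> v"
  have "bilinear (g p)" and pos: "\<And>u. u \<noteq> 0 \<Longrightarrow> g p u u > 0"
    using g \<open>p \<in> U\<close> by (auto simp: riemannian_manifold_def)
  then have "g p (w' - w) (w' - w) = 0"
    using w w' by (simp add: bilinear_lsub)
  then show "w' = w" using pos[of "w' - w"] by force
qed

text \<open>
  This is an instance of the bilinearity of the Christoffel symbols. Of the three terms in the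
  defining covector, two are derivatives of functions that vanish near \<open>p\<close>, and the third is a
  derivative in direction 0.
\<close>

lemma christoffel_zero_right:
  assumes g: "riemannian_manifold U g" and "p \<in> U"
  shows "christoffel g p u 0 = 0"
proof -
  have U: "open U" and bil: "\<And>q. q \<in> U \<Longrightarrow> bilinear (g q)"
    and smooth: "smooth_map_on U (\<lambda>q. g q u w)" for w
    using g by (auto simp: riemannian_manifold_def)
  have "D (\<lambda>q. g q 0 w) p = (\<lambda>_. 0)" "D (\<lambda>q. g q u 0) p = (\<lambda>_. 0)" for w
    using differentiable_cong_open(2)[OF U \<open>p \<in> U\<close>, of _ "\<lambda>_. 0 :: real"] bil
    by (simp_all add: bilinear_lzero bilinear_rzero)
  moreover have "D (\<lambda>q. g q u w) p 0 = 0" for w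
  proof -
    have "Ck_on (Suc 0) U (\<lambda>q. g q u w)"
      using smooth unfolding smooth_map_on_def by blast
    then show ?thesis
      using Ck_on_SucD(1)[OF _ \<open>p \<in> U\<close>, THEN has_derivative_linear, THEN linear_0] by blast
  qed
  ultimately show ?thesis
    unfolding christoffel_def
    by (intro sharp_eqI[OF assms]) (simp add: bil[OF \<open>p \<in> U\<close>] bilinear_lzero)
qed

section \<open>Maps into a flat target with parallel tension field\<close>

text \<open>
  A covariant derivative of the tension field is zero on all of \<open>U\<close>, for every direction field,
  and a section that is zero on an open set has zero covariant derivative there. So the rough
  Laplacian vanishes before the trace is taken.
\<close>

lemma bitension_field_zero_if_parallel:
  fixes g :: "'a::euclidean_space metric_tensor" and h :: "'b::euclidean_space metric_tensor"
  assumes "smooth_manifold_map U g V h \<phi>" "p \<in> U"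
    and parallel: "\<And>q X. q \<in> U \<Longrightarrow> pullback_connection h \<phi> X (tension_field g h \<phi>) q = 0"
    and flat: "\<And>q u v w. q \<in> V \<Longrightarrow> curvature_at h q u v w = 0"
  shows "bitension_field g h \<phi> p = 0"
proof -
  have U: "open U" and h: "riemannian_manifold V h" and V: "\<phi> p \<in> V"
    using assms(1,2) by (auto simp: smooth_manifold_map_def riemannian_manifold_def)
  have "D (pullback_connection h \<phi> X (tension_field g h \<phi>)) p = (\<lambda>_. 0)" for X
    using differentiable_cong_open(2)[OF U \<open>p \<in> U\<close>, of _ "\<lambda>_. 0", OF parallel] by simp
  then have "pullback_connection h \<phi> (\<lambda>_. u)
      (pullback_connection h \<phi> X (tension_field g h \<phi>)) p = 0" for u X
    using parallel[OF \<open>p \<in> U\<close>] christoffel_zero_right[OF h V]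
    by (simp add: pullback_connection_def[of _ _ "\<lambda>_. u"])
  then show ?thesis
    using parallel[OF \<open>p \<in> U\<close>] flat[OF V]
    by (simp add: bitension_field_def metric_trace_def second_covariant_derivative_def)
qed

section \<open>The three metrics\<close>

lemma open_half_plane: "open half_plane"
proof -
  have eq: "half_plane = {p. 0 < snd p}" by (auto simp: half_plane_def)
  show ?thesis unfolding eq by (intro open_Collect_less continuous_intros)
qed

lemma open_target_half_plane: "open target_half_plane"
proof -
  have eq: "target_half_plane = {p. 0 < fst p}" by (auto simp: target_half_plane_def)
  show ?thesis unfolding eq by (intro open_Collect_less continuous_intros)
qed

lemma open_upper_half_space: "open upper_half_space"
proof -
  have eq: "upper_half_space = {p. 0 < fst (snd p)}" by (auto simp: upper_half_space_def)
  show ?thesis unfolding eq by (intro open_Collect_less continuous_intros)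
qed

lemma hyperbolic_metric_proj: "hyperbolic_metric c p u v =
    (fst u * fst v + snd u * snd v) / (- c * (snd p)\<^sup>2)"
  by (simp add: hyperbolic_metric_def split_beta)

lemma source_metric_proj: "source_metric a p u v =
    a\<^sup>2 * (fst u * fst v + fst (snd u) * fst (snd v)) / (fst (snd p))\<^sup>2 + snd (snd u) * snd (snd v)"
  by (simp add: source_metric_def split_beta)

lemma target_metric_proj: "target_metric a p u v =
    a\<^sup>2 * (fst u * fst v) / (fst p)\<^sup>2 + snd u * snd v"
  by (simp add: target_metric_def split_beta)

lemma riemannian_hyperbolic:
  assumes "c < 0"
  shows "riemannian_manifold half_plane (hyperbolic_metric c)"
  unfolding riemannian_manifold_def
proof (intro conjI allI ballI open_half_plane impI)
  fix p :: "real \<times> real" assume p: "p \<in> half_plane"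
  show "bilinear (hyperbolic_metric c p)"
    by (auto simp: bilinear_def hyperbolic_metric_proj add_divide_distrib algebra_simps intro!: linearI)
  show "hyperbolic_metric c p u v = hyperbolic_metric c p v u" for u v
    by (simp add: hyperbolic_metric_proj mult.commute)
  show "hyperbolic_metric c p u u > 0" if "u \<noteq> 0" for u
  proof -
    have "fst u * fst u + snd u * snd u > 0"
      using that by (metis prod_eq_iff zero_prod_def fst_conv snd_conv sum_squares_gt_zero_iff)
    moreover have "- c * (snd p)\<^sup>2 > 0"
      using assms p by (auto simp: half_plane_def mult_neg_pos)
    ultimately show ?thesis unfolding hyperbolic_metric_proj by (rule divide_pos_pos)
  qed
next
  show "smooth_map_on half_plane (\<lambda>p. hyperbolic_metric c p u v)" for u v
    unfolding hyperbolic_metric_proj using assms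
    by (intro smooth_intros open_half_plane) (auto simp: half_plane_def)
qed

lemma riemannian_source:
  assumes "a > 0"
  shows "riemannian_manifold upper_half_space (source_metric a)"
  unfolding riemannian_manifold_def
proof (intro conjI allI ballI open_upper_half_space impI)
  fix p :: "real \<times> real \<times> real" assume p: "p \<in> upper_half_space"
  show "bilinear (source_metric a p)"
    by (auto simp: bilinear_def source_metric_proj add_divide_distrib algebra_simps intro!: linearI)
  show "source_metric a p u v = source_metric a p v u" for u v
    by (simp add: source_metric_proj mult.commute)
  show "source_metric a p u u > 0" if "u \<noteq> 0" for u
  proof -
    obtain x y z where p_eq: "p = (x, y, z)" by (cases p)
    obtain u1 u2 u3 where u_eq: "u = (u1, u2, u3)" by (cases u)
    define k where "k = a\<^sup>2 / y\<^sup>2"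
    have "k > 0" using assms p by (simp add: k_def p_eq upper_half_space_def)
    moreover have "u1 \<noteq> 0 \<or> u2 \<noteq> 0 \<or> u3 \<noteq> 0" using that by (auto simp: u_eq zero_prod_def)
    ultimately have "k * (u1 * u1 + u2 * u2) + u3 * u3 > 0"
      by (cases "u3 = 0")
         (auto simp: sum_squares_gt_zero_iff zero_less_mult_iff intro!: add_nonneg_pos)
    then show ?thesis by (simp add: source_metric_proj p_eq u_eq k_def)
  qed
next
  show "smooth_map_on upper_half_space (\<lambda>p. source_metric a p u v)" for u v
    unfolding source_metric_proj
    by (intro smooth_intros open_upper_half_space) (auto simp: upper_half_space_def)
qed

lemma riemannian_target:
  assumes "a > 0"
  shows "riemannian_manifold target_half_plane (target_metric a)"
  unfolding riemannian_manifold_def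
proof (intro conjI allI ballI open_target_half_plane impI)
  fix p :: "real \<times> real" assume p: "p \<in> target_half_plane"
  show "bilinear (target_metric a p)"
    by (auto simp: bilinear_def target_metric_proj add_divide_distrib algebra_simps intro!: linearI)
  show "target_metric a p u v = target_metric a p v u" for u v
    by (simp add: target_metric_proj mult.commute)
  show "target_metric a p u u > 0" if "u \<noteq> 0" for u
  proof -
    obtain y z where p_eq: "p = (y, z)" by (cases p)
    obtain u1 u2 where u_eq: "u = (u1, u2)" by (cases u)
    define k where "k = a\<^sup>2 / y\<^sup>2"
    have "k > 0" using assms p by (simp add: k_def p_eq target_half_plane_def)
    moreover have "u1 \<noteq> 0 \<or> u2 \<noteq> 0" using that by (auto simp: u_eq zero_prod_def)
    ultimately have "k * (u1 * u1) + u2 * u2 > 0"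
      by (cases "u2 = 0") (auto simp: zero_less_mult_iff intro!: add_nonneg_pos)
    then show ?thesis by (simp add: target_metric_proj p_eq u_eq k_def)
  qed
next
  show "smooth_map_on target_half_plane (\<lambda>p. target_metric a p u v)" for u v
    unfolding target_metric_proj
    by (intro smooth_intros open_target_half_plane) (auto simp: target_half_plane_def)
qed


section \<open>Curvature of the two half-planes\<close>

lemma levi_civita_const: "levi_civita g (\<lambda>_. u) (\<lambda>_. v) p = christoffel g p u v"
  by (simp add: levi_civita_def)

text \<open>
  For constant fields the covariant derivative is the Christoffel symbol alone, and the last term is
  the derivative in the direction of their bracket.
\<close>

lemma curvature_at_christoffel:
  "curvature_at g p u v w =
     D (\<lambda>q. christoffel g q v w) p u + christoffel g p u (christoffel g p v w)
     - (D (\<lambda>q. christoffel g q u w) p v + christoffel g p v (christoffel g p u w))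
     - christoffel g p 0 w"
proof -
  have "levi_civita g (\<lambda>_. u) (\<lambda>_. v) = (\<lambda>q. christoffel g q u v)" for u v
    by (rule ext) (rule levi_civita_const)
  then show ?thesis
    by (simp add: curvature_at_def curvature_def levi_civita_def[of _ _ "\<lambda>q. christoffel g q _ _"]
        lie_bracket_def levi_civita_const)
qed

lemma D_inverse_coordinate:
  fixes L :: "'a::euclidean_space \<Rightarrow> real" and B :: "'b::euclidean_space"
  assumes "bounded_linear L" "L p \<noteq> 0"
  shows "D (\<lambda>q. inverse (L q) *\<^sub>R B) p = (\<lambda>w. - (L w / (L p)\<^sup>2) *\<^sub>R B)"
proof (rule has_derivative_D)
  have L: "(L has_derivative L) (at p)"
    using assms(1) by (rule bounded_linear_imp_has_derivative)
  show "((\<lambda>q. inverse (L q) *\<^sub>R B) has_derivative (\<lambda>w. - (L w / (L p)\<^sup>2) *\<^sub>R B)) (at p)"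
    by (rule derivative_eq_intros L assms(2) refl)+
       (simp add: fun_eq_iff power2_eq_square divide_inverse)
qed

lemma D_hyperbolic_metric:
  assumes "c < 0" "p \<in> half_plane"
  shows "D (\<lambda>q. hyperbolic_metric c q v w) p =
    (\<lambda>u. 2 * (fst v * fst w + snd v * snd w) * snd u / (c * (snd p) ^ 3))"
  unfolding hyperbolic_metric_proj using assms
  by (intro has_derivative_D)
     (auto simp: half_plane_def fun_eq_iff field_simps power2_eq_square power3_eq_cube
       intro!: derivative_eq_intros)

lemma D_target_metric:
  assumes "p \<in> target_half_plane"
  shows "D (\<lambda>q. target_metric a q v w) p =
    (\<lambda>u. - 2 * a\<^sup>2 * (fst v * fst w) * fst u / (fst p) ^ 3)"
  unfolding target_metric_proj using assms
  by (intro has_derivative_D)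
     (auto simp: target_half_plane_def fun_eq_iff field_simps power2_eq_square power3_eq_cube
       intro!: derivative_eq_intros)

lemma D_source_metric:
  assumes "p \<in> upper_half_space"
  shows "D (\<lambda>q. source_metric a q v w) p =
    (\<lambda>u. - 2 * a\<^sup>2 * (fst v * fst w + fst (snd v) * fst (snd w)) * fst (snd u) / (fst (snd p)) ^ 3)"
  unfolding source_metric_proj using assms
  by (intro has_derivative_D)
     (auto simp: upper_half_space_def fun_eq_iff field_simps power2_eq_square power3_eq_cube
       intro!: derivative_eq_intros)

text \<open>
  A constant factor of the metric cancels between lowering and raising an index, so the symbols do
  not depend on \<open>c\<close>. The curvature enters below only through the metric itself.
\<close>

lemma christoffel_hyperbolic:
  assumes "c < 0" "p \<in> half_plane"
  shows "christoffel (hyperbolic_metric c) p u v =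
    inverse (snd p) *\<^sub>R (- (fst u * snd v + snd u * fst v), fst u * fst v - snd u * snd v)"
  unfolding christoffel_def
proof (rule sharp_eqI[OF riemannian_hyperbolic[OF assms(1)] assms(2)])
  have "snd p > 0" using assms(2) by (auto simp: half_plane_def)
  then show "hyperbolic_metric c p
      (inverse (snd p) *\<^sub>R (- (fst u * snd v + snd u * fst v), fst u * fst v - snd u * snd v)) w =
    (D (\<lambda>q. hyperbolic_metric c q v w) p u + D (\<lambda>q. hyperbolic_metric c q u w) p v -
      D (\<lambda>q. hyperbolic_metric c q u v) p w) / 2" for w
    unfolding D_hyperbolic_metric[OF assms] unfolding hyperbolic_metric_proj
    using assms(1) by (simp add: field_simps power2_eq_square power3_eq_cube)
qed

lemma christoffel_target:
  assumes "a > 0" "p \<in> target_half_plane"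
  shows "christoffel (target_metric a) p u v = inverse (fst p) *\<^sub>R (- (fst u * fst v), 0)"
  unfolding christoffel_def
proof (rule sharp_eqI[OF riemannian_target[OF assms(1)] assms(2)])
  have "fst p > 0" using assms(2) by (auto simp: target_half_plane_def)
  then show "target_metric a p (inverse (fst p) *\<^sub>R (- (fst u * fst v), 0)) w =
    (D (\<lambda>q. target_metric a q v w) p u + D (\<lambda>q. target_metric a q u w) p v -
      D (\<lambda>q. target_metric a q u v) p w) / 2" for w
    unfolding D_target_metric[OF assms(2)] unfolding target_metric_proj
    by (simp add: field_simps power2_eq_square power3_eq_cube)
qed

text \<open>
  The symbols of a Riemannian product are those of its factors: the hyperbolic ones in the
  coordinates $x, y$ and none in the direction $z$.
\<close>

lemma christoffel_source:
  assumes "a > 0" "p \<in> upper_half_space"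
  shows "christoffel (source_metric a) p u v = inverse (fst (snd p)) *\<^sub>R
    (- (fst u * fst (snd v) + fst (snd u) * fst v), fst u * fst v - fst (snd u) * fst (snd v), 0)"
    (is "_ = ?w")
  unfolding christoffel_def
proof (rule sharp_eqI[OF riemannian_source[OF assms(1)] assms(2)])
  have "fst (snd p) > 0" using assms(2) by (auto simp: upper_half_space_def)
  then show "source_metric a p ?w w =
    (D (\<lambda>q. source_metric a q v w) p u + D (\<lambda>q. source_metric a q u w) p v -
      D (\<lambda>q. source_metric a q u v) p w) / 2" for w
    unfolding D_source_metric[OF assms(2)] unfolding source_metric_proj
    by (simp add: field_simps power2_eq_square power3_eq_cube)
qed

lemma constant_curvature_hyperbolic:
  assumes "c < 0"
  shows "constant_curvature half_plane (hyperbolic_metric c) c"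
  unfolding constant_curvature_def
proof (intro conjI ballI allI riemannian_hyperbolic assms)
  fix p u v :: "real \<times> real" assume p: "p \<in> half_plane"
  obtain x y where p_eq: "p = (x, y)" by (cases p)
  have y: "y > 0" using p by (simp add: p_eq half_plane_def)
  obtain u1 u2 where u_eq: "u = (u1, u2)" by (cases u)
  obtain v1 v2 where v_eq: "v = (v1, v2)" by (cases v)
  note \<Gamma> = christoffel_hyperbolic[OF assms]
  have D\<Gamma>: "D (\<lambda>q. christoffel (hyperbolic_metric c) q v w) p = (\<lambda>u.
      - (snd u / (snd p)\<^sup>2) *\<^sub>R (- (fst v * snd w + snd v * fst w), fst v * fst w - snd v * snd w))"
    for v w
    by (rule trans[OF differentiable_cong_open(2)[OF open_half_plane p \<Gamma>]
          D_inverse_coordinate[OF bounded_linear_snd]])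
       (use y in \<open>simp_all add: p_eq\<close>)
  show "hyperbolic_metric c p (curvature_at (hyperbolic_metric c) p u v v) u =
      c * (hyperbolic_metric c p u u * hyperbolic_metric c p v v - (hyperbolic_metric c p u v)\<^sup>2)"
    unfolding curvature_at_christoffel D\<Gamma> unfolding \<Gamma>[OF p] hyperbolic_metric_proj
    using y assms
    by (simp add: p_eq u_eq v_eq field_simps power2_eq_square)
qed

text \<open>
  The only nonzero symbol involves $\partial_y$ alone, so the expression for the curvature is symmetric
  in \<open>u\<close> and \<open>v\<close> before it is antisymmetrised.
\<close>

lemma curvature_target_zero:
  assumes "a > 0" "p \<in> target_half_plane"
  shows "curvature_at (target_metric a) p u v w = 0"
proof -
  have y: "fst p > 0" using assms(2) by (auto simp: target_half_plane_def)
  note \<Gamma> = christoffel_target[OF assms(1)]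
  have D\<Gamma>: "D (\<lambda>q. christoffel (target_metric a) q v w) p =
      (\<lambda>u. - (fst u / (fst p)\<^sup>2) *\<^sub>R (- (fst v * fst w), 0))" for v w
    by (rule trans[OF differentiable_cong_open(2)[OF open_target_half_plane assms(2) \<Gamma>]
          D_inverse_coordinate[OF bounded_linear_fst]])
       (use y in simp_all)
  show ?thesis
    unfolding curvature_at_christoffel D\<Gamma> unfolding \<Gamma>[OF assms(2)]
    using y by (simp add: field_simps power2_eq_square zero_prod_def)
qed


section \<open>The two isometries\<close>

lemma isometry_betweenI:
  assumes g: "riemannian_manifold U g" and h: "riemannian_manifold V h"
    and "\<phi> ` U \<subseteq> V" "\<psi> ` V \<subseteq> U"
    and "\<And>p. p \<in> U \<Longrightarrow> \<psi> (\<phi> p) = p" "\<And>q. q \<in> V \<Longrightarrow> \<phi> (\<psi> q) = q"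
    and "smooth_map_on U \<phi>" "smooth_map_on V \<psi>"
    and "\<And>p u v. p \<in> U \<Longrightarrow> h (\<phi> p) (D \<phi> p u) (D \<phi> p v) = g p u v"
  shows "isometry_between U g V h \<phi>"
proof -
  have bij: "bij_betw \<phi> U V"
    using assms(3-6) by (intro bij_betw_byWitness[where f' = \<psi>]) auto
  have "inv_into U \<phi> q = \<psi> q" if "q \<in> V" for q
    using assms(4,6) that bij by (intro inv_into_f_eq) (auto simp: bij_betw_def)
  moreover have "open V" using h by (simp add: riemannian_manifold_def)
  ultimately have "smooth_map_on V (inv_into U \<phi>)"
    using assms(8) smooth_cong[of V "inv_into U \<phi>" \<psi>] by simp
  then show ?thesis
    using assms bij by (simp add: isometry_between_def smooth_manifold_map_def)
qed

lemma riemannian_flat: "riemannian_manifold (UNIV :: 'a::euclidean_space set) flat_metric"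
proof -
  have "flat_metric p = (\<bullet>)" for p :: 'a by (simp add: fun_eq_iff flat_metric_def)
  then show ?thesis
    by (simp add: riemannian_manifold_def inner_commute smooth_const
        bilinear_conv_bounded_bilinear bounded_bilinear_inner)
qed

lemma isometry_log:
  assumes "a > 0"
  shows "isometry_between target_half_plane (target_metric a) UNIV flat_metric
    (\<lambda>(y, z). (a * ln y, z))"
proof -
  let ?\<phi> = "\<lambda>p :: real \<times> real. (a * ln (fst p), snd p)"
  let ?\<psi> = "\<lambda>q :: real \<times> real. (exp (fst q / a), snd q)"
  have "isometry_between target_half_plane (target_metric a) UNIV flat_metric ?\<phi>"
  proof (rule isometry_betweenI[OF riemannian_target[OF assms] riemannian_flat, of _ ?\<psi>])
    show "smooth_map_on target_half_plane ?\<phi>"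
      by (intro smooth_intros open_target_half_plane) (auto simp: target_half_plane_def)
    show "smooth_map_on UNIV ?\<psi>"
      by (intro smooth_intros open_UNIV) (use assms in auto)
    fix p u v :: "real \<times> real" assume p: "p \<in> target_half_plane"
    then have y: "fst p > 0" by (auto simp: target_half_plane_def)
    have "D ?\<phi> p = (\<lambda>u. (a * fst u / fst p, snd u))"
      using y by (intro has_derivative_D)
        (auto intro!: derivative_eq_intros simp: fun_eq_iff divide_inverse)
    then show "flat_metric (?\<phi> p) (D ?\<phi> p u) (D ?\<phi> p v) = target_metric a p u v"
      using y by (simp add: flat_metric_def target_metric_proj inner_prod_def power2_eq_square)
  qed (use assms in \<open>auto simp: target_half_plane_def\<close>)
  then show ?thesis by (simp add: case_prod_unfold)
qed

lemma product_metric_proj: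
  assumes "a > 0"
  shows "product_metric (hyperbolic_metric (- 1 / a\<^sup>2)) flat_metric p u v =
    a\<^sup>2 * (fst (fst u) * fst (fst v) + snd (fst u) * snd (fst v)) / (snd (fst p))\<^sup>2 + snd u * snd v"
  unfolding product_metric_def hyperbolic_metric_def flat_metric_def
  using assms by (simp add: split_beta field_simps)

lemma isometry_product:
  assumes "a > 0"
  shows "isometry_between (half_plane \<times> (UNIV :: real set))
    (product_metric (hyperbolic_metric (- 1 / a\<^sup>2)) flat_metric)
    upper_half_space (source_metric a) (\<lambda>((x, y), z). (x, y, z))"
proof -
  let ?U = "half_plane \<times> (UNIV :: real set)"
  let ?g = "product_metric (hyperbolic_metric (- 1 / a\<^sup>2)) flat_metric
    :: ((real \<times> real) \<times> real) metric_tensor"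
  let ?\<phi> = "\<lambda>p :: (real \<times> real) \<times> real. (fst (fst p), snd (fst p), snd p)"
  let ?\<psi> = "\<lambda>q :: real \<times> real \<times> real. ((fst q, fst (snd q)), snd (snd q))"
  have U: "open ?U" by (intro open_Times open_half_plane open_UNIV)
  \<comment> \<open>Positive definiteness and the isometry property both reduce to this identity.\<close>
  have pullback: "source_metric a (?\<phi> p) (?\<phi> u) (?\<phi> v) = ?g p u v" for p u v
    unfolding product_metric_proj[OF assms] source_metric_proj by simp
  have maps: "?\<phi> p \<in> upper_half_space" if "p \<in> ?U" for p
    using that by (auto simp: half_plane_def upper_half_space_def)
  have g: "riemannian_manifold ?U ?g"
    unfolding riemannian_manifold_def
  proof (intro conjI allI ballI U impI)
    fix p assume p: "p \<in> ?U"
    show "bilinear (?g p)"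
      unfolding bilinear_def product_metric_proj[OF assms]
      by (auto simp: add_divide_distrib algebra_simps intro!: linearI)
    show "?g p u v = ?g p v u" for u v
      unfolding product_metric_proj[OF assms] by (simp add: mult.commute)
    show "?g p u u > 0" if "u \<noteq> 0" for u
    proof -
      have "?\<phi> u \<noteq> 0" using that by (auto simp: prod_eq_iff)
      then show ?thesis
        using riemannian_source[OF assms] maps[OF p]
        unfolding riemannian_manifold_def pullback[symmetric] by blast
    qed
  next
    show "smooth_map_on ?U (\<lambda>p. ?g p u v)" for u v
      unfolding product_metric_proj[OF assms]
      by (intro smooth_intros U) (auto simp: half_plane_def)
  qed
  have "isometry_between ?U ?g upper_half_space (source_metric a) ?\<phi>"
  proof (rule isometry_betweenI[OF g riemannian_source[OF assms], of _ ?\<psi>])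
    show "smooth_map_on ?U ?\<phi>" by (intro smooth_intros U)
    show "smooth_map_on upper_half_space ?\<psi>" by (intro smooth_intros open_upper_half_space)
    show "source_metric a (?\<phi> p) (D ?\<phi> p u) (D ?\<phi> p v) = ?g p u v" for p u v
    proof -
      have "D ?\<phi> p = ?\<phi>"
        by (intro has_derivative_D) (auto intro!: derivative_eq_intros)
      then show ?thesis by (simp only: pullback)
    qed
  qed (auto simp: half_plane_def upper_half_space_def)
  then show ?thesis by (simp add: case_prod_unfold)
qed

section \<open>The projection\<close>

lemma proj_eq_snd: "proj = snd"
  by (auto simp: proj_def)

lemma D_proj: "D proj p = proj"
  unfolding proj_eq_snd by (intro has_derivative_D has_derivative_snd has_derivative_ident)

lemma proj_in_target: "p \<in> upper_half_space \<Longrightarrow> proj p \<in> target_half_plane"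
  by (auto simp: proj_def upper_half_space_def target_half_plane_def)

lemma smooth_manifold_map_proj:
  assumes "a > 0"
  shows "smooth_manifold_map upper_half_space (source_metric a) target_half_plane (target_metric a) proj"
  using assms proj_in_target smooth_snd[OF open_upper_half_space]
  by (auto simp: smooth_manifold_map_def riemannian_source riemannian_target proj_eq_snd)

lemma riemannian_submersion_proj:
  assumes "a > 0"
  shows "riemannian_submersion upper_half_space (source_metric a) target_half_plane (target_metric a) proj"
  unfolding riemannian_submersion_def Let_def D_proj
proof (intro conjI ballI smooth_manifold_map_proj assms)
  show "proj ` upper_half_space = target_half_plane"
    by (force simp: proj_def upper_half_space_def target_half_plane_def image_iff)
  show "surj proj" by (simp add: proj_eq_snd)
next
  fix p u v :: "real \<times> real \<times> real"
  assume p: "p \<in> upper_half_space"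
    and u: "u \<in> {u. \<forall>k. proj k = 0 \<longrightarrow> source_metric a p u k = 0}"
  \<comment> \<open>The vector (1, 0) is \<open>\<partial>\<^sub>x\<close>, which spans the kernel of the differential.\<close>
  have "source_metric a p u (1, 0) = 0"
    using u by (simp add: proj_eq_snd)
  then have "fst u = 0"
    using p assms by (auto simp: source_metric_proj upper_half_space_def)
  then show "target_metric a (proj p) (proj u) (proj v) = source_metric a p u v"
    by (simp add: target_metric_proj source_metric_proj proj_eq_snd)
qed

lemma sharp_source_metric:
  assumes "a > 0" "p \<in> upper_half_space"
  shows "sharp (source_metric a) p (\<lambda>v. b \<bullet> v) =
    ((fst (snd p))\<^sup>2 / a\<^sup>2 * fst b, (fst (snd p))\<^sup>2 / a\<^sup>2 * fst (snd b), snd (snd b))"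
  using assms
  by (intro sharp_eqI[OF riemannian_source])
     (auto simp: source_metric_proj inner_prod_def upper_half_space_def field_simps)

text \<open>
  The symbols $\Gamma^y_{yy} = -1/y$ of source and target cancel. What remains is
  $-\Gamma^y_{xx} = -1/y$ of the source, the bending of the horocycle fibres.
\<close>

lemma second_fundamental_form_proj:
  assumes "a > 0" "p \<in> upper_half_space"
  shows "second_fundamental_form (source_metric a) (target_metric a) proj p u v =
    inverse (fst (snd p)) *\<^sub>R (- (fst u * fst v), 0)"
  unfolding second_fundamental_form_def pullback_connection_def levi_civita_const D_proj
    christoffel_source[OF assms] christoffel_target[OF assms(1) proj_in_target[OF assms(2)]]
  by (simp add: proj_eq_snd algebra_simps)

lemma sum_Basis_prod:
  "(\<Sum>b\<in>Basis. f b) = (\<Sum>i\<in>Basis. f (i, 0)) + (\<Sum>j\<in>Basis. f (0, j))"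
  for f :: "'a::euclidean_space \<times> 'b::euclidean_space \<Rightarrow> 'c::comm_monoid_add"
  unfolding Basis_prod_def
  by (subst sum.union_disjoint) (auto simp: sum.reindex inj_on_def)

lemma tension_field_proj:
  assumes "a > 0" "p \<in> upper_half_space"
  shows "tension_field (source_metric a) (target_metric a) proj p = (- (fst (snd p) / a\<^sup>2), 0)"
  unfolding tension_field_def metric_trace_def second_fundamental_form_proj[OF assms]
    sharp_source_metric[OF assms]
  using assms by (auto simp: sum_Basis_prod upper_half_space_def power2_eq_square)

text \<open>
  For a direction whose image in the target is $(w_1, w_2)$, the derivative of the
  $y$-component $-y/a^2$ is $-w_1/a^2$, and the symbol $\Gamma^y_{yy} = -1/y$ contributes
  $+w_1/a^2$.
\<close>

lemma tension_field_proj_parallel: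
  assumes "a > 0" "p \<in> upper_half_space"
  shows "pullback_connection (target_metric a) proj X
    (tension_field (source_metric a) (target_metric a) proj) p = 0"
proof -
  have "D (tension_field (source_metric a) (target_metric a) proj) p =
      D (\<lambda>q. (- (fst (snd q) / a\<^sup>2), 0)) p"
    by (rule differentiable_cong_open(2)[OF open_upper_half_space assms(2)
          tension_field_proj[OF assms(1)]])
  also have "\<dots> = (\<lambda>w. (- (fst (snd w) / a\<^sup>2), 0))"
    using assms(1) by (intro has_derivative_D)
      (auto intro!: derivative_eq_intros simp: fun_eq_iff field_simps power2_eq_square power4_eq_xxxx)
  finally have D: "D (tension_field (source_metric a) (target_metric a) proj) p =
    (\<lambda>w. (- (fst (snd w) / a\<^sup>2), 0))" .
  have "fst (snd p) > 0" using assms(2) by (auto simp: upper_half_space_def)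
  then show ?thesis
    unfolding pullback_connection_def D D_proj tension_field_proj[OF assms]
      christoffel_target[OF assms(1) proj_in_target[OF assms(2)]]
    by (simp add: proj_eq_snd zero_prod_def)
qed

lemma proper_biharmonic_proj:
  assumes "a > 0"
  shows "proper_biharmonic_map upper_half_space (source_metric a) target_half_plane (target_metric a) proj"
proof -
  note smooth = smooth_manifold_map_proj[OF assms]
  have "bitension_field (source_metric a) (target_metric a) proj p = 0"
    if "p \<in> upper_half_space" for p
    using bitension_field_zero_if_parallel[OF smooth that] tension_field_proj_parallel[OF assms]
      curvature_target_zero[OF assms] by blast
  moreover have "(0, 1, 0) \<in> upper_half_space"
    by (simp add: upper_half_space_def)
  moreover from this have "tension_field (source_metric a) (target_metric a) proj (0, 1, 0) \<noteq> 0"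
    using tension_field_proj[OF assms] assms by (simp add: zero_prod_def)
  ultimately show ?thesis
    using smooth by (auto simp: proper_biharmonic_map_def biharmonic_map_def harmonic_map_def)
qed

theorem corollary4p2:
  shows
    "(\<forall>a::real. a > 0 \<longrightarrow>
        constant_curvature half_plane (hyperbolic_metric (- 1 / a\<^sup>2)) (- 1 / a\<^sup>2)
      \<and> isometry_between
          (half_plane \<times> (UNIV :: real set))
          (product_metric (hyperbolic_metric (- 1 / a\<^sup>2)) flat_metric)
          upper_half_space (source_metric a)
          (\<lambda>((x, y), z). (x, y, z))
      \<and> isometry_between
          target_half_plane (target_metric a)
          (UNIV :: (real \<times> real) set) flat_metric
          (\<lambda>(y, z). (a * ln y, z))
      \<and> riemannian_submersion
          upper_half_space (source_metric a) target_half_plane (target_metric a) proj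
      \<and> proper_biharmonic_map
          upper_half_space (source_metric a) target_half_plane (target_metric a) proj)
   \<and> (let g = (\<lambda>(x, y, z) (u1, u2, u3) (v1, v2, v3). (u1 * v1 + u2 * v2) / y\<^sup>2 + u3 * v3);
          h = (\<lambda>(y, z) (u1, u2) (v1, v2). u1 * v1 / y\<^sup>2 + u2 * v2)
      in isometry_between
           (half_plane \<times> (UNIV :: real set))
           (product_metric (hyperbolic_metric (- 1)) flat_metric)
           upper_half_space g
           (\<lambda>((x, y), z). (x, y, z))
       \<and> riemannian_submersion upper_half_space g target_half_plane h proj
       \<and> proper_biharmonic_map upper_half_space g target_half_plane h proj)"
proof -
  have hyperbolic: "hyperbolic_metric (- 1) = hyperbolic_metric (- 1 / 1\<^sup>2)" by simp
  have source: "(\<lambda>(x, y, z) (u1, u2, u3) (v1, v2, v3). (u1 * v1 + u2 * v2) / y\<^sup>2 + u3 * v3)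
      = source_metric 1"
    by (simp add: source_metric_def)
  have target: "(\<lambda>(y, z) (u1, u2) (v1, v2). u1 * v1 / y\<^sup>2 + u2 * v2) = target_metric 1"
    by (simp add: target_metric_def)
  show ?thesis
    unfolding Let_def source target hyperbolic
    by (intro conjI allI impI constant_curvature_hyperbolic isometry_product isometry_log
        riemannian_submersion_proj proper_biharmonic_proj) auto
qed

end
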